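(* For every $\Sigma$-sentence $\phi$ of $\mathcal{L}_{BT}$: if $\mathfrak{B}\models\phi$, then $B\vdash\phi$.
   Context: Bit strings are elements of $\{\mathbf{0},\mathbf{1}\}^*$; $\varepsilon$ is the empty string. The first-order language $\mathcal{L}_{BT}$ has constant symbols $e,0,1$, a binary function symbol $\circ$ (also written as juxtaposition, $st$ for $s\circ t$), and a binary relation symbol $\sqsubseteq$. The $\mathcal{L}_{BT}$-structure $\mathfrak{B}$ has universe $\{\mathbf{0},\mathbf{1}\}^*$, interprets $e$ as $\varepsilon$, $0$ as $\mathbf{0}$, $1$ as $\mathbf{1}$, $\circ$ as concatenation, and $\sqsubseteq$ as the substring relation ($\alpha\sqsubseteq\beta$ iff $\gamma\alpha\delta=\beta$ for some bit strings $\gamma,\delta$). Bounded quantifiers: $(\exists x\sqsubseteq t)\phi$ abbreviates $\exists x[x\sqsubseteq t\wedge\phi]$ and $(\forall x\sqsubseteq t)\phi$ abbreviates $\forall x[x\sqsubseteq t\to\phi]$. $\Sigma$-formulas are defined inductively: $s\sqsubseteq t$, $\neg s\sqsubseteq t$, $s=t$, $\neg s=t$ (for terms $s,t$) are $\Sigma$-formulas; if $\phi,\psi$ are $\Sigma$-formulas then so are $\phi\wedge\psi$ and $\phi\vee\psi$; if $\phi$ is a $\Sigma$-formula, $t$ a term and $x$ a variable not occurring in $t$, then $(\exists x\sqsubseteq t)\phi$, $(\forall x\sqsubseteq t)\phi$ and $\exists x\,\phi$ are $\Sigma$-formulas. The theory $B$ has the eleven axioms: (1) $\forall x[x=ex\wedge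 x=xe]$; (2) $\forall xyz[(xy)z=x(yz)]$; (3) $\forall xy[x\neq y\to(x0\neq y0\wedge x1\neq y1)]$; (4) $\forall xy[x0\neq y1]$; (5) $\forall x[x\sqsubseteq e\leftrightarrow x=e]$; (6) $\forall x[x\sqsubseteq 0\leftrightarrow(x=e\vee x=0)]$; (7) $\forall x[x\sqsubseteq 1\leftrightarrow(x=e\vee x=1)]$; (8)–(11): for each $a,b\in\{0,1\}$, $\forall xy[x\sqsubseteq ayb\leftrightarrow(x=ayb\vee x\sqsubseteq ay\vee x\sqsubseteq yb)]$. *)

theory Defs
  imports "HOL-Library.Sublist"
begin

datatype tm =
    Var nat
  | Empt  ("\<^bold>e")
  | Zero  ("\<^bold>0")
  | One   ("\<^bold>1")
  | Cat tm tm  (infixl "\<^bold>\<circ>" 75)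

datatype fm =
    Eq tm tm      (infix "\<^bold>=" 55)
  | Sub tm tm     (infix "\<^bold>\<sqsubseteq>" 55)
  | Neg fm        ("\<^bold>\<not> _" [54] 54)
  | Conj fm fm    (infixr "\<^bold>\<and>" 53)
  | Disj fm fm    (infixr "\<^bold>\<or>" 52)
  | Imp fm fm     (infixr "\<^bold>\<longrightarrow>" 51)
  | Forall nat fm
  | Exists nat fm

abbreviation Iff :: "fm \<Rightarrow> fm \<Rightarrow> fm"  (infixr "\<^bold>\<longleftrightarrow>" 50) where
  "\<phi> \<^bold>\<longleftrightarrow> \<psi> \<equiv> (\<phi> \<^bold>\<longrightarrow> \<psi>) \<^bold>\<and> (\<psi> \<^bold>\<longrightarrow> \<phi>)"

abbreviation Neq :: "tm \<Rightarrow> tm \<Rightarrow> fm"  (infix "\<^bold>\<noteq>" 55) where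
  "s \<^bold>\<noteq> t \<equiv> \<^bold>\<not> (s \<^bold>= t)"

abbreviation BExists :: "nat \<Rightarrow> tm \<Rightarrow> fm \<Rightarrow> fm" where
  "BExists x t \<phi> \<equiv> Exists x (Var x \<^bold>\<sqsubseteq> t \<^bold>\<and> \<phi>)"

abbreviation BForall :: "nat \<Rightarrow> tm \<Rightarrow> fm \<Rightarrow> fm" where
  "BForall x t \<phi> \<equiv> Forall x (Var x \<^bold>\<sqsubseteq> t \<^bold>\<longrightarrow> \<phi>)"

fun tvars :: "tm \<Rightarrow> nat set" where
  "tvars (Var x) = {x}"
| "tvars \<^bold>e = {}"
| "tvars \<^bold>0 = {}"
| "tvars \<^bold>1 = {}"
| "tvars (s \<^bold>\<circ> t) = tvars s \<union> tvars t"

fun fvars :: "fm \<Rightarrow> nat set" where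
  "fvars (s \<^bold>= t) = tvars s \<union> tvars t"
| "fvars (s \<^bold>\<sqsubseteq> t) = tvars s \<union> tvars t"
| "fvars (\<^bold>\<not> \<phi>) = fvars \<phi>"
| "fvars (\<phi> \<^bold>\<and> \<psi>) = fvars \<phi> \<union> fvars \<psi>"
| "fvars (\<phi> \<^bold>\<or> \<psi>) = fvars \<phi> \<union> fvars \<psi>"
| "fvars (\<phi> \<^bold>\<longrightarrow> \<psi>) = fvars \<phi> \<union> fvars \<psi>"
| "fvars (Forall x \<phi>) = fvars \<phi> - {x}"
| "fvars (Exists x \<phi>) = fvars \<phi> - {x}"

definition sentence :: "fm \<Rightarrow> bool" where
  "sentence \<phi> \<longleftrightarrow> fvars \<phi> = {}"

inductive Sigma_fm :: "fm \<Rightarrow> bool" where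
  "Sigma_fm (s \<^bold>\<sqsubseteq> t)"
| "Sigma_fm (\<^bold>\<not> (s \<^bold>\<sqsubseteq> t))"
| "Sigma_fm (s \<^bold>= t)"
| "Sigma_fm (\<^bold>\<not> (s \<^bold>= t))"
| "Sigma_fm \<phi> \<Longrightarrow> Sigma_fm \<psi> \<Longrightarrow> Sigma_fm (\<phi> \<^bold>\<and> \<psi>)"
| "Sigma_fm \<phi> \<Longrightarrow> Sigma_fm \<psi> \<Longrightarrow> Sigma_fm (\<phi> \<^bold>\<or> \<psi>)"
| "Sigma_fm \<phi> \<Longrightarrow> x \<notin> tvars t \<Longrightarrow> Sigma_fm (BExists x t \<phi>)"
| "Sigma_fm \<phi> \<Longrightarrow> x \<notin> tvars t \<Longrightarrow> Sigma_fm (BForall x t \<phi>)"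
| "Sigma_fm \<phi> \<Longrightarrow> Sigma_fm (Exists x \<phi>)"

text \<open>The universe of a structure is the whole type \<open>'a\<close>.\<close>

record 'a struct =
  int_e :: 'a
  int_0 :: 'a
  int_1 :: 'a
  int_cat :: "'a \<Rightarrow> 'a \<Rightarrow> 'a"
  int_sub :: "'a \<Rightarrow> 'a \<Rightarrow> bool"

fun tval :: "'a struct \<Rightarrow> (nat \<Rightarrow> 'a) \<Rightarrow> tm \<Rightarrow> 'a" where
  "tval M a (Var x) = a x"
| "tval M a \<^bold>e = int_e M"
| "tval M a \<^bold>0 = int_0 M"
| "tval M a \<^bold>1 = int_1 M"
| "tval M a (s \<^bold>\<circ> t) = int_cat M (tval M a s) (tval M a t)"

fun sat :: "'a struct \<Rightarrow> (nat \<Rightarrow> 'a) \<Rightarrow> fm \<Rightarrow> bool" where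
  "sat M a (s \<^bold>= t) \<longleftrightarrow> tval M a s = tval M a t"
| "sat M a (s \<^bold>\<sqsubseteq> t) \<longleftrightarrow> int_sub M (tval M a s) (tval M a t)"
| "sat M a (\<^bold>\<not> \<phi>) \<longleftrightarrow> \<not> sat M a \<phi>"
| "sat M a (\<phi> \<^bold>\<and> \<psi>) \<longleftrightarrow> sat M a \<phi> \<and> sat M a \<psi>"
| "sat M a (\<phi> \<^bold>\<or> \<psi>) \<longleftrightarrow> sat M a \<phi> \<or> sat M a \<psi>"
| "sat M a (\<phi> \<^bold>\<longrightarrow> \<psi>) \<longleftrightarrow> (sat M a \<phi> \<longrightarrow> sat M a \<psi>)"
| "sat M a (Forall x \<phi>) \<longleftrightarrow> (\<forall>d. sat M (a(x := d)) \<phi>)"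
| "sat M a (Exists x \<phi>) \<longleftrightarrow> (\<exists>d. sat M (a(x := d)) \<phi>)"

definition models :: "'a struct \<Rightarrow> fm \<Rightarrow> bool"  (infix "\<Turnstile>" 45) where
  "M \<Turnstile> \<phi> \<longleftrightarrow> (\<forall>a. sat M a \<phi>)"

text \<open>Bit strings are Boolean lists; \<open>False\<close> is the bit 0 and \<open>True\<close> is the bit 1.\<close>

definition BT_struct :: "bool list struct"  ("\<BB>") where
  "\<BB> = \<lparr> int_e = [], int_0 = [False], int_1 = [True], int_cat = (@), int_sub = sublist \<rparr>"

fun tsubst :: "tm \<Rightarrow> nat \<Rightarrow> tm \<Rightarrow> tm" where
  "tsubst (Var y) x t = (if y = x then t else Var y)"
| "tsubst \<^bold>e x t = \<^bold>e"
| "tsubst \<^bold>0 x t = \<^bold>0"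
| "tsubst \<^bold>1 x t = \<^bold>1"
| "tsubst (r \<^bold>\<circ> s) x t = tsubst r x t \<^bold>\<circ> tsubst s x t"

text \<open>Bound variables are never renamed, so \<open>subst \<phi> x t\<close> is meaningful only under
  \<open>free_for t x \<phi>\<close>, which says that no variable of \<open>t\<close> gets captured.\<close>

fun subst :: "fm \<Rightarrow> nat \<Rightarrow> tm \<Rightarrow> fm" where
  "subst (r \<^bold>= s) x t = (tsubst r x t \<^bold>= tsubst s x t)"
| "subst (r \<^bold>\<sqsubseteq> s) x t = (tsubst r x t \<^bold>\<sqsubseteq> tsubst s x t)"
| "subst (\<^bold>\<not> \<phi>) x t = \<^bold>\<not> (subst \<phi> x t)"
| "subst (\<phi> \<^bold>\<and> \<psi>) x t = (subst \<phi> x t \<^bold>\<and> subst \<psi> x t)"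
| "subst (\<phi> \<^bold>\<or> \<psi>) x t = (subst \<phi> x t \<^bold>\<or> subst \<psi> x t)"
| "subst (\<phi> \<^bold>\<longrightarrow> \<psi>) x t = (subst \<phi> x t \<^bold>\<longrightarrow> subst \<psi> x t)"
| "subst (Forall y \<phi>) x t = Forall y (if y = x then \<phi> else subst \<phi> x t)"
| "subst (Exists y \<phi>) x t = Exists y (if y = x then \<phi> else subst \<phi> x t)"

fun free_for :: "tm \<Rightarrow> nat \<Rightarrow> fm \<Rightarrow> bool" where
  "free_for t x (r \<^bold>= s) \<longleftrightarrow> True"
| "free_for t x (r \<^bold>\<sqsubseteq> s) \<longleftrightarrow> True"
| "free_for t x (\<^bold>\<not> \<phi>) \<longleftrightarrow> free_for t x \<phi>"
| "free_for t x (\<phi> \<^bold>\<and> \<psi>) \<longleftrightarrow> free_for t x \<phi> \<and> free_for t x \<psi>"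
| "free_for t x (\<phi> \<^bold>\<or> \<psi>) \<longleftrightarrow> free_for t x \<phi> \<and> free_for t x \<psi>"
| "free_for t x (\<phi> \<^bold>\<longrightarrow> \<psi>) \<longleftrightarrow> free_for t x \<phi> \<and> free_for t x \<psi>"
| "free_for t x (Forall y \<phi>) \<longleftrightarrow> x \<notin> fvars (Forall y \<phi>) \<or> (y \<notin> tvars t \<and> free_for t x \<phi>)"
| "free_for t x (Exists y \<phi>) \<longleftrightarrow> x \<notin> fvars (Exists y \<phi>) \<or> (y \<notin> tvars t \<and> free_for t x \<phi>)"

text \<open>Classical natural deduction with equality. In \<open>allI\<close> and \<open>exE\<close> the eigenvariable is \<open>y\<close>.
  Weakening is a rule of its own because the eigenvariable conditions would otherwise
  obstruct it when infinitely many variables are free in \<open>\<Gamma>\<close>.\<close>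

inductive derives :: "fm set \<Rightarrow> fm \<Rightarrow> bool"  (infix "\<turnstile>" 45) where
  assm: "\<phi> \<in> \<Gamma> \<Longrightarrow> \<Gamma> \<turnstile> \<phi>"
| weaken: "\<Gamma> \<turnstile> \<phi> \<Longrightarrow> \<Gamma> \<subseteq> \<Delta> \<Longrightarrow> \<Delta> \<turnstile> \<phi>"
| conjI: "\<Gamma> \<turnstile> \<phi> \<Longrightarrow> \<Gamma> \<turnstile> \<psi> \<Longrightarrow> \<Gamma> \<turnstile> \<phi> \<^bold>\<and> \<psi>"
| conjE1: "\<Gamma> \<turnstile> \<phi> \<^bold>\<and> \<psi> \<Longrightarrow> \<Gamma> \<turnstile> \<phi>"
| conjE2: "\<Gamma> \<turnstile> \<phi> \<^bold>\<and> \<psi> \<Longrightarrow> \<Gamma> \<turnstile> \<psi>"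
| disjI1: "\<Gamma> \<turnstile> \<phi> \<Longrightarrow> \<Gamma> \<turnstile> \<phi> \<^bold>\<or> \<psi>"
| disjI2: "\<Gamma> \<turnstile> \<psi> \<Longrightarrow> \<Gamma> \<turnstile> \<phi> \<^bold>\<or> \<psi>"
| disjE: "\<Gamma> \<turnstile> \<phi> \<^bold>\<or> \<psi> \<Longrightarrow> insert \<phi> \<Gamma> \<turnstile> \<chi> \<Longrightarrow> insert \<psi> \<Gamma> \<turnstile> \<chi> \<Longrightarrow> \<Gamma> \<turnstile> \<chi>"
| impI: "insert \<phi> \<Gamma> \<turnstile> \<psi> \<Longrightarrow> \<Gamma> \<turnstile> \<phi> \<^bold>\<longrightarrow> \<psi>"
| impE: "\<Gamma> \<turnstile> \<phi> \<^bold>\<longrightarrow> \<psi> \<Longrightarrow> \<Gamma> \<turnstile> \<phi> \<Longrightarrow> \<Gamma> \<turnstile> \<psi>"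
| negI: "insert \<phi> \<Gamma> \<turnstile> \<psi> \<Longrightarrow> insert \<phi> \<Gamma> \<turnstile> \<^bold>\<not> \<psi> \<Longrightarrow> \<Gamma> \<turnstile> \<^bold>\<not> \<phi>"
| negE: "\<Gamma> \<turnstile> \<phi> \<Longrightarrow> \<Gamma> \<turnstile> \<^bold>\<not> \<phi> \<Longrightarrow> \<Gamma> \<turnstile> \<psi>"
| dneg: "\<Gamma> \<turnstile> \<^bold>\<not> \<^bold>\<not> \<phi> \<Longrightarrow> \<Gamma> \<turnstile> \<phi>"
| allI: "\<Gamma> \<turnstile> subst \<phi> x (Var y) \<Longrightarrow> free_for (Var y) x \<phi> \<Longrightarrow>
    y \<notin> fvars (Forall x \<phi>) \<Longrightarrow> (\<forall>\<psi>\<in>\<Gamma>. y \<notin> fvars \<psi>) \<Longrightarrow> \<Gamma> \<turnstile> Forall x \<phi>"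
| allE: "\<Gamma> \<turnstile> Forall x \<phi> \<Longrightarrow> free_for t x \<phi> \<Longrightarrow> \<Gamma> \<turnstile> subst \<phi> x t"
| exI: "\<Gamma> \<turnstile> subst \<phi> x t \<Longrightarrow> free_for t x \<phi> \<Longrightarrow> \<Gamma> \<turnstile> Exists x \<phi>"
| exE: "\<Gamma> \<turnstile> Exists x \<phi> \<Longrightarrow> insert (subst \<phi> x (Var y)) \<Gamma> \<turnstile> \<chi> \<Longrightarrow> free_for (Var y) x \<phi> \<Longrightarrow>
    y \<notin> fvars (Exists x \<phi>) \<Longrightarrow> y \<notin> fvars \<chi> \<Longrightarrow> (\<forall>\<psi>\<in>\<Gamma>. y \<notin> fvars \<psi>) \<Longrightarrow> \<Gamma> \<turnstile> \<chi>"
| eq_refl: "\<Gamma> \<turnstile> t \<^bold>= t"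
| eq_subst: "\<Gamma> \<turnstile> s \<^bold>= t \<Longrightarrow> \<Gamma> \<turnstile> subst \<phi> x s \<Longrightarrow> free_for s x \<phi> \<Longrightarrow> free_for t x \<phi> \<Longrightarrow>
    \<Gamma> \<turnstile> subst \<phi> x t"

definition ax_sub :: "tm \<Rightarrow> tm \<Rightarrow> fm" where
  "ax_sub a b = (let x = Var 0; y = Var 1 in
    Forall 0 (Forall 1 (x \<^bold>\<sqsubseteq> a \<^bold>\<circ> y \<^bold>\<circ> b \<^bold>\<longleftrightarrow>
      (x \<^bold>= a \<^bold>\<circ> y \<^bold>\<circ> b \<^bold>\<or> x \<^bold>\<sqsubseteq> a \<^bold>\<circ> y \<^bold>\<or> x \<^bold>\<sqsubseteq> y \<^bold>\<circ> b))))"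

definition theory_B :: "fm set" where
  "theory_B = (let x = Var 0; y = Var 1; z = Var 2 in
    { Forall 0 (x \<^bold>= \<^bold>e \<^bold>\<circ> x \<^bold>\<and> x \<^bold>= x \<^bold>\<circ> \<^bold>e),
      Forall 0 (Forall 1 (Forall 2 ((x \<^bold>\<circ> y) \<^bold>\<circ> z \<^bold>= x \<^bold>\<circ> (y \<^bold>\<circ> z)))),
      Forall 0 (Forall 1 (x \<^bold>\<noteq> y \<^bold>\<longrightarrow> (x \<^bold>\<circ> \<^bold>0 \<^bold>\<noteq> y \<^bold>\<circ> \<^bold>0 \<^bold>\<and> x \<^bold>\<circ> \<^bold>1 \<^bold>\<noteq> y \<^bold>\<circ> \<^bold>1))),
      Forall 0 (Forall 1 (x \<^bold>\<circ> \<^bold>0 \<^bold>\<noteq> y \<^bold>\<circ> \<^bold>1)),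
      Forall 0 (x \<^bold>\<sqsubseteq> \<^bold>e \<^bold>\<longleftrightarrow> x \<^bold>= \<^bold>e),
      Forall 0 (x \<^bold>\<sqsubseteq> \<^bold>0 \<^bold>\<longleftrightarrow> (x \<^bold>= \<^bold>e \<^bold>\<or> x \<^bold>= \<^bold>0)),
      Forall 0 (x \<^bold>\<sqsubseteq> \<^bold>1 \<^bold>\<longleftrightarrow> (x \<^bold>= \<^bold>e \<^bold>\<or> x \<^bold>= \<^bold>1)),
      ax_sub \<^bold>0 \<^bold>0, ax_sub \<^bold>0 \<^bold>1, ax_sub \<^bold>1 \<^bold>0, ax_sub \<^bold>1 \<^bold>1 })"

end

theory Submission imports Defs begin

text \<open>
  Every bit string \<open>w\<close> is named by a closed term \<open>num w\<close>, and \<open>B\<close> decides all atomic sentences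
  about these names. A true \<open>\<Sigma>\<close>-formula is derived under an assignment \<open>a\<close>, which is represented by
  the hypotheses \<open>Var x = num (a x)\<close> rather than by a simultaneous substitution. The only hard
  connective is the bounded universal quantifier: by the axioms (5)--(11), the assumption
  \<open>s \<sqsubseteq> num v\<close> splits into the finitely many cases \<open>s = num d\<close> with \<open>d\<close> a substring of \<open>v\<close>.
  The same case split refutes false atoms \<open>num u \<sqsubseteq> num v\<close>.
\<close>

section \<open>Substitution\<close>

lemma tsubst_fresh: "x \<notin> tvars t \<Longrightarrow> tsubst t x r = t"
  by (induction t) auto

lemma tsubst_Var_self [simp]: "tsubst t x (Var x) = t"
  by (induction t) auto

text \<open>Lets a bound variable act as its own eigenvariable in \<open>allI\<close>, so that
  generalization involves no renaming.\<close>

lemma subst_Var_self [simp]: "subst \<phi> x (Var x) = \<phi>"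
  by (induction \<phi>) auto

lemma free_for_Var_self [simp]: "free_for (Var x) x \<phi>"
  by (induction \<phi>) auto

lemma free_for_closed: "tvars t = {} \<Longrightarrow> free_for t x \<phi>"
  by (induction \<phi>) auto

lemma finite_tvars: "finite (tvars t)"
  by (induction t) auto

lemma fresh_var_exists: "\<exists>x. x \<notin> tvars s \<and> x \<notin> tvars t"
proof -
  have "finite (tvars s \<union> tvars t)"
    by (simp add: finite_tvars)
  then obtain x where "x \<notin> tvars s \<union> tvars t"
    using ex_new_if_finite infinite_UNIV_nat by blast
  then show ?thesis
    by auto
qed

section \<open>Derived rules\<close>

lemma derives_cut:
  assumes "\<Gamma> \<turnstile> \<phi>" and "insert \<phi> \<Gamma> \<turnstile> \<psi>"
  shows "\<Gamma> \<turnstile> \<psi>"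
  by (rule derives.impE[OF derives.impI[OF assms(2)] assms(1)])

lemma derives_insert: "\<Gamma> \<turnstile> \<phi> \<Longrightarrow> insert \<psi> \<Gamma> \<turnstile> \<phi>"
  by (erule derives.weaken) auto

lemma derives_hyp: "insert \<phi> \<Gamma> \<turnstile> \<phi>"
  by (rule derives.assm) simp

text \<open>Leibniz replacement, with a fresh \<open>x\<close> marking the occurrence to be
  replaced: the pattern read at \<open>s\<close> is reflexivity, read at \<open>t\<close> the goal.
  Transitivity and the congruences for \<open>Cat\<close> and \<open>Sub\<close> mark positions in
  the same way.\<close>

lemma derives_sym:
  assumes "\<Gamma> \<turnstile> s \<^bold>= t"
  shows "\<Gamma> \<turnstile> t \<^bold>= s"
proof -
  obtain x where x: "x \<notin> tvars s"
    using fresh_var_exists by blast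
  show ?thesis
    using derives.eq_subst[OF assms, where x = x and \<phi> = "Var x \<^bold>= s"] x
    by (simp add: tsubst_fresh derives.eq_refl)
qed

lemma derives_trans [trans]:
  assumes "\<Gamma> \<turnstile> r \<^bold>= s" and "\<Gamma> \<turnstile> s \<^bold>= t"
  shows "\<Gamma> \<turnstile> r \<^bold>= t"
proof -
  obtain x where x: "x \<notin> tvars r"
    using fresh_var_exists by blast
  show ?thesis
    using derives.eq_subst[OF assms(2), where x = x and \<phi> = "r \<^bold>= Var x"] x assms(1)
    by (simp add: tsubst_fresh)
qed

lemma derives_Cat_cong:
  assumes "\<Gamma> \<turnstile> s \<^bold>= s'" and "\<Gamma> \<turnstile> t \<^bold>= t'"
  shows "\<Gamma> \<turnstile> s \<^bold>\<circ> t \<^bold>= s' \<^bold>\<circ> t'"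
proof -
  obtain x where x: "x \<notin> tvars s" "x \<notin> tvars t"
    using fresh_var_exists by blast
  obtain y where y: "y \<notin> tvars s'" "y \<notin> tvars (s \<^bold>\<circ> t)"
    using fresh_var_exists by blast
  have "\<Gamma> \<turnstile> s \<^bold>\<circ> t \<^bold>= s' \<^bold>\<circ> t"
    using derives.eq_subst[OF assms(1), where x = x and \<phi> = "s \<^bold>\<circ> t \<^bold>= Var x \<^bold>\<circ> t"] x
    by (simp add: tsubst_fresh derives.eq_refl)
  then show ?thesis
    using derives.eq_subst[OF assms(2), where x = y and \<phi> = "s \<^bold>\<circ> t \<^bold>= s' \<^bold>\<circ> Var y"] y
    by (simp add: tsubst_fresh)
qed

lemma derives_Sub_cong:
  assumes "\<Gamma> \<turnstile> s \<^bold>= s'" and "\<Gamma> \<turnstile> t \<^bold>= t'" and "\<Gamma> \<turnstile> s \<^bold>\<sqsubseteq> t"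
  shows "\<Gamma> \<turnstile> s' \<^bold>\<sqsubseteq> t'"
proof -
  obtain x where x: "x \<notin> tvars t"
    using fresh_var_exists by blast
  obtain y where y: "y \<notin> tvars s'"
    using fresh_var_exists by blast
  have "\<Gamma> \<turnstile> s' \<^bold>\<sqsubseteq> t"
    using derives.eq_subst[OF assms(1), where x = x and \<phi> = "Var x \<^bold>\<sqsubseteq> t"] x assms(3)
    by (simp add: tsubst_fresh)
  then show ?thesis
    using derives.eq_subst[OF assms(2), where x = y and \<phi> = "s' \<^bold>\<sqsubseteq> Var y"] y
    by (simp add: tsubst_fresh)
qed

text \<open>Runs from primed to unprimed terms, opposite to \<open>derives_Sub_cong\<close>:
  assuming \<open>s\<close> and \<open>t\<close> equal, the given equations would equate
  \<open>s'\<close> and \<open>t'\<close>.\<close>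

lemma derives_Neq_cong:
  assumes "\<Gamma> \<turnstile> s \<^bold>= s'" and "\<Gamma> \<turnstile> t \<^bold>= t'" and "\<Gamma> \<turnstile> s' \<^bold>\<noteq> t'"
  shows "\<Gamma> \<turnstile> s \<^bold>\<noteq> t"
proof (rule derives.negI[OF _ derives_insert[OF assms(3)]])
  let ?\<Delta> = "insert (s \<^bold>= t) \<Gamma>"
  have "?\<Delta> \<turnstile> s' \<^bold>= s"
    by (rule derives_sym[OF derives_insert[OF assms(1)]])
  also have "?\<Delta> \<turnstile> s \<^bold>= t"
    by (rule derives_hyp)
  also have "?\<Delta> \<turnstile> t \<^bold>= t'"
    by (rule derives_insert[OF assms(2)])
  finally show "?\<Delta> \<turnstile> s' \<^bold>= t'" .
qed

section \<open>Instances of the axioms\<close>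

lemma theory_B_closed: "\<psi> \<in> theory_B \<Longrightarrow> fvars \<psi> = {}"
  by (auto simp: theory_B_def ax_sub_def Let_def)

lemma derives_axiom: "theory_B \<subseteq> \<Gamma> \<Longrightarrow> \<psi> \<in> theory_B \<Longrightarrow> \<Gamma> \<turnstile> \<psi>"
  by (rule derives.assm) auto

lemma B_unit:
  assumes "theory_B \<subseteq> \<Gamma>"
  shows "\<Gamma> \<turnstile> t \<^bold>= \<^bold>e \<^bold>\<circ> t" and "\<Gamma> \<turnstile> t \<^bold>= t \<^bold>\<circ> \<^bold>e"
proof -
  have "\<Gamma> \<turnstile> Forall 0 (Var 0 \<^bold>= \<^bold>e \<^bold>\<circ> Var 0 \<^bold>\<and> Var 0 \<^bold>= Var 0 \<^bold>\<circ> \<^bold>e)"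
    by (rule derives_axiom[OF assms]) (simp add: theory_B_def Let_def)
  from derives.allE[OF this, of t]
  have "\<Gamma> \<turnstile> t \<^bold>= \<^bold>e \<^bold>\<circ> t \<^bold>\<and> t \<^bold>= t \<^bold>\<circ> \<^bold>e"
    by simp
  then show "\<Gamma> \<turnstile> t \<^bold>= \<^bold>e \<^bold>\<circ> t" and "\<Gamma> \<turnstile> t \<^bold>= t \<^bold>\<circ> \<^bold>e"
    by (rule derives.conjE1, rule derives.conjE2)
qed

text \<open>The terms are inserted beneath quantifiers; closedness prevents capture and keeps later
  substitutions from altering terms already inserted.\<close>

lemma B_assoc:
  assumes "theory_B \<subseteq> \<Gamma>" and "tvars r = {}" "tvars s = {}" "tvars t = {}"
  shows "\<Gamma> \<turnstile> (r \<^bold>\<circ> s) \<^bold>\<circ> t \<^bold>= r \<^bold>\<circ> (s \<^bold>\<circ> t)"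
proof -
  have "\<Gamma> \<turnstile> Forall 0 (Forall 1 (Forall 2
      ((Var 0 \<^bold>\<circ> Var 1) \<^bold>\<circ> Var 2 \<^bold>= Var 0 \<^bold>\<circ> (Var 1 \<^bold>\<circ> Var 2))))"
    by (rule derives_axiom[OF assms(1)]) (simp add: theory_B_def Let_def)
  from derives.allE[OF this, of r]
  have "\<Gamma> \<turnstile> Forall 1 (Forall 2 ((r \<^bold>\<circ> Var 1) \<^bold>\<circ> Var 2 \<^bold>= r \<^bold>\<circ> (Var 1 \<^bold>\<circ> Var 2)))"
    using assms by (simp add: tsubst_fresh)
  from derives.allE[OF this, of s]
  have "\<Gamma> \<turnstile> Forall 2 ((r \<^bold>\<circ> s) \<^bold>\<circ> Var 2 \<^bold>= r \<^bold>\<circ> (s \<^bold>\<circ> Var 2))"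
    using assms by (simp add: tsubst_fresh)
  from derives.allE[OF this, of t]
  show ?thesis
    using assms by (simp add: tsubst_fresh)
qed

definition bit_tm :: "bool \<Rightarrow> tm" where
  "bit_tm b = (if b then \<^bold>1 else \<^bold>0)"

lemma tvars_bit_tm [simp]: "tvars (bit_tm b) = {}"
  by (simp add: bit_tm_def)

lemma B_snoc_cancel:
  assumes "theory_B \<subseteq> \<Gamma>" and "tvars s = {}" "tvars t = {}" and "\<Gamma> \<turnstile> s \<^bold>\<noteq> t"
  shows "\<Gamma> \<turnstile> s \<^bold>\<circ> bit_tm b \<^bold>\<noteq> t \<^bold>\<circ> bit_tm b"
proof -
  have "\<Gamma> \<turnstile> Forall 0 (Forall 1 (Var 0 \<^bold>\<noteq> Var 1 \<^bold>\<longrightarrow>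
      (Var 0 \<^bold>\<circ> \<^bold>0 \<^bold>\<noteq> Var 1 \<^bold>\<circ> \<^bold>0 \<^bold>\<and> Var 0 \<^bold>\<circ> \<^bold>1 \<^bold>\<noteq> Var 1 \<^bold>\<circ> \<^bold>1)))"
    by (rule derives_axiom[OF assms(1)]) (simp add: theory_B_def Let_def)
  from derives.allE[OF this, of s]
  have "\<Gamma> \<turnstile> Forall 1 (s \<^bold>\<noteq> Var 1 \<^bold>\<longrightarrow>
      (s \<^bold>\<circ> \<^bold>0 \<^bold>\<noteq> Var 1 \<^bold>\<circ> \<^bold>0 \<^bold>\<and> s \<^bold>\<circ> \<^bold>1 \<^bold>\<noteq> Var 1 \<^bold>\<circ> \<^bold>1))"
    using assms by (simp add: tsubst_fresh)
  from derives.allE[OF this, of t]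
  have "\<Gamma> \<turnstile> s \<^bold>\<noteq> t \<^bold>\<longrightarrow> (s \<^bold>\<circ> \<^bold>0 \<^bold>\<noteq> t \<^bold>\<circ> \<^bold>0 \<^bold>\<and> s \<^bold>\<circ> \<^bold>1 \<^bold>\<noteq> t \<^bold>\<circ> \<^bold>1)"
    using assms by (simp add: tsubst_fresh)
  from derives.impE[OF this assms(4)] show ?thesis
    by (auto simp: bit_tm_def intro: derives.conjE1 derives.conjE2)
qed

lemma B_snoc_distinct:
  assumes "theory_B \<subseteq> \<Gamma>" and "tvars s = {}" "tvars t = {}"
  shows "\<Gamma> \<turnstile> s \<^bold>\<circ> \<^bold>0 \<^bold>\<noteq> t \<^bold>\<circ> \<^bold>1"
proof -
  have "\<Gamma> \<turnstile> Forall 0 (Forall 1 (Var 0 \<^bold>\<circ> \<^bold>0 \<^bold>\<noteq> Var 1 \<^bold>\<circ> \<^bold>1))"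
    by (rule derives_axiom[OF assms(1)]) (simp add: theory_B_def Let_def)
  from derives.allE[OF this, of s]
  have "\<Gamma> \<turnstile> Forall 1 (s \<^bold>\<circ> \<^bold>0 \<^bold>\<noteq> Var 1 \<^bold>\<circ> \<^bold>1)"
    using assms by (simp add: tsubst_fresh)
  from derives.allE[OF this, of t] show ?thesis
    using assms by (simp add: tsubst_fresh)
qed

lemma derives_Neq_sym:
  assumes "\<Gamma> \<turnstile> s \<^bold>\<noteq> t"
  shows "\<Gamma> \<turnstile> t \<^bold>\<noteq> s"
  by (rule derives.negI[OF derives_sym[OF derives_hyp] derives_insert[OF assms]])

lemma B_snoc_distinct_bits:
  assumes "theory_B \<subseteq> \<Gamma>" and "tvars s = {}" "tvars t = {}" and "b \<noteq> c"
  shows "\<Gamma> \<turnstile> s \<^bold>\<circ> bit_tm b \<^bold>\<noteq> t \<^bold>\<circ> bit_tm c"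
  using assms B_snoc_distinct[of \<Gamma> s t] derives_Neq_sym[OF B_snoc_distinct[of \<Gamma> t s]]
  by (auto simp: bit_tm_def)

lemma B_Sub_empty:
  assumes "theory_B \<subseteq> \<Gamma>"
  shows "\<Gamma> \<turnstile> s \<^bold>\<sqsubseteq> \<^bold>e \<^bold>\<longleftrightarrow> s \<^bold>= \<^bold>e"
proof -
  have "\<Gamma> \<turnstile> Forall 0 (Var 0 \<^bold>\<sqsubseteq> \<^bold>e \<^bold>\<longleftrightarrow> Var 0 \<^bold>= \<^bold>e)"
    by (rule derives_axiom[OF assms]) (simp add: theory_B_def Let_def)
  from derives.allE[OF this, of s] show ?thesis
    by simp
qed

lemma B_Sub_bit:
  assumes "theory_B \<subseteq> \<Gamma>"
  shows "\<Gamma> \<turnstile> s \<^bold>\<sqsubseteq> bit_tm b \<^bold>\<longleftrightarrow> (s \<^bold>= \<^bold>e \<^bold>\<or> s \<^bold>= bit_tm b)"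
proof -
  have "\<Gamma> \<turnstile> Forall 0 (Var 0 \<^bold>\<sqsubseteq> bit_tm b \<^bold>\<longleftrightarrow> (Var 0 \<^bold>= \<^bold>e \<^bold>\<or> Var 0 \<^bold>= bit_tm b))"
    by (rule derives_axiom[OF assms]) (simp add: theory_B_def Let_def bit_tm_def)
  from derives.allE[OF this, of s] show ?thesis
    by (simp add: tsubst_fresh)
qed

text \<open>The term \<open>s\<close> may contain the variable bound by the inner quantifier of the axiom, so that
  quantifier is instantiated first and the outer one reintroduced.\<close>

lemma B_Sub_Cat:
  assumes "theory_B \<subseteq> \<Gamma>" and t: "tvars t = {}"
  shows "\<Gamma> \<turnstile> s \<^bold>\<sqsubseteq> bit_tm b \<^bold>\<circ> t \<^bold>\<circ> bit_tm c \<^bold>\<longleftrightarrow>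
    (s \<^bold>= bit_tm b \<^bold>\<circ> t \<^bold>\<circ> bit_tm c \<^bold>\<or> s \<^bold>\<sqsubseteq> bit_tm b \<^bold>\<circ> t \<^bold>\<or> s \<^bold>\<sqsubseteq> t \<^bold>\<circ> bit_tm c)"
proof -
  define \<beta> where "\<beta> r u = (r \<^bold>\<sqsubseteq> bit_tm b \<^bold>\<circ> u \<^bold>\<circ> bit_tm c \<^bold>\<longleftrightarrow>
    (r \<^bold>= bit_tm b \<^bold>\<circ> u \<^bold>\<circ> bit_tm c \<^bold>\<or> r \<^bold>\<sqsubseteq> bit_tm b \<^bold>\<circ> u \<^bold>\<or> r \<^bold>\<sqsubseteq> u \<^bold>\<circ> bit_tm c))" for r u
  have "ax_sub (bit_tm b) (bit_tm c) \<in> theory_B"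
    by (simp add: theory_B_def Let_def bit_tm_def)
  \<comment> \<open>The derivation runs over \<open>theory_B\<close> alone: \<Gamma> might contain
    \<open>Var 0\<close> free, which would block reintroducing the outer quantifier. Weakening to
    \<Gamma> comes last.\<close>
  then have "theory_B \<turnstile> Forall 0 (Forall 1 (\<beta> (Var 0) (Var 1)))"
    by (intro derives_axiom) (simp_all add: ax_sub_def Let_def \<beta>_def)
  from derives.allE[OF this, of "Var 0"]
  have "theory_B \<turnstile> Forall 1 (\<beta> (Var 0) (Var 1))"
    by simp
  from derives.allE[OF this, of t]
  have "theory_B \<turnstile> \<beta> (Var 0) t"
    using t by (simp add: \<beta>_def tsubst_fresh)
  then have "theory_B \<turnstile> Forall 0 (\<beta> (Var 0) t)"
    by (intro derives.allI[where y = 0]) (auto simp: theory_B_closed)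
  from derives.allE[OF this, of s]
  have "theory_B \<turnstile> \<beta> s t"
    using t by (simp add: \<beta>_def tsubst_fresh)
  then show ?thesis
    using assms(1) unfolding \<beta>_def by (rule derives.weaken)
qed

section \<open>Numerals\<close>

text \<open>Names are nested to the right and end in the empty-string constant, so
  \<open>num [b]\<close> is not literally \<open>bit_tm b\<close>. Axioms (3) and (4) look at the
  last bit instead, hence the conversions below.\<close>

fun num :: "bool list \<Rightarrow> tm" where
  "num [] = \<^bold>e"
| "num (b # w) = bit_tm b \<^bold>\<circ> num w"

lemma tvars_num [simp]: "tvars (num w) = {}"
  by (induction w) auto

lemma num_append:
  assumes "theory_B \<subseteq> \<Gamma>"
  shows "\<Gamma> \<turnstile> num (u @ v) \<^bold>= num u \<^bold>\<circ> num v"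
proof (induction u)
  case Nil
  show ?case
    using B_unit(1)[OF assms] by simp
next
  case (Cons b u)
  have "\<Gamma> \<turnstile> num ((b # u) @ v) \<^bold>= bit_tm b \<^bold>\<circ> (num u \<^bold>\<circ> num v)"
    using derives_Cat_cong[OF derives.eq_refl Cons.IH] by simp
  also have "\<Gamma> \<turnstile> bit_tm b \<^bold>\<circ> (num u \<^bold>\<circ> num v) \<^bold>= num (b # u) \<^bold>\<circ> num v"
    using derives_sym[OF B_assoc[OF assms]] by simp
  finally show ?case .
qed

lemma num_single: "theory_B \<subseteq> \<Gamma> \<Longrightarrow> \<Gamma> \<turnstile> num [b] \<^bold>= bit_tm b"
  using derives_sym[OF B_unit(2)] by simp

lemma num_snoc:
  assumes "theory_B \<subseteq> \<Gamma>"
  shows "\<Gamma> \<turnstile> num (w @ [b]) \<^bold>= num w \<^bold>\<circ> bit_tm b"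
  by (rule derives_trans[OF num_append[OF assms]])
    (rule derives_Cat_cong[OF derives.eq_refl num_single[OF assms]])

text \<open>Brings a name of length at least two into the shape in which axioms (8)-(11) speak of
  it.\<close>

lemma num_Cons_snoc:
  assumes "theory_B \<subseteq> \<Gamma>"
  shows "\<Gamma> \<turnstile> num (b # w @ [c]) \<^bold>= bit_tm b \<^bold>\<circ> num w \<^bold>\<circ> bit_tm c"
  using num_snoc[OF assms, of "b # w" c] by simp

text \<open>If \<open>num w \<circ> bit_tm b = e\<close>, then prefixing the opposite bit \<open>c\<close> yields
  \<open>(c \<circ> num w) \<circ> bit_tm b = e \<circ> c\<close>, against axiom (4).\<close>

lemma num_snoc_neq_empty:
  assumes "theory_B \<subseteq> \<Gamma>"
  shows "\<Gamma> \<turnstile> num (w @ [b]) \<^bold>\<noteq> \<^bold>e"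
proof (rule derives.negI)
  let ?\<Delta> = "insert (num (w @ [b]) \<^bold>= \<^bold>e) \<Gamma>"
  let ?c = "bit_tm (\<not> b)"
  have B: "theory_B \<subseteq> ?\<Delta>"
    using assms by auto
  have "?\<Delta> \<turnstile> ?c \<^bold>\<circ> num w \<^bold>\<circ> bit_tm b \<^bold>= num ((\<not> b) # w @ [b])"
    by (rule derives_sym[OF num_Cons_snoc[OF B]])
  also have "?\<Delta> \<turnstile> num ((\<not> b) # w @ [b]) \<^bold>= ?c \<^bold>\<circ> \<^bold>e"
    by (simp add: derives_Cat_cong derives.eq_refl derives_hyp)
  also have "?\<Delta> \<turnstile> ?c \<^bold>\<circ> \<^bold>e \<^bold>= ?c"
    by (rule derives_sym[OF B_unit(2)[OF B]])
  also have "?\<Delta> \<turnstile> ?c \<^bold>= \<^bold>e \<^bold>\<circ> ?c"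
    by (rule B_unit(1)[OF B])
  finally show "?\<Delta> \<turnstile> ?c \<^bold>\<circ> num w \<^bold>\<circ> bit_tm b \<^bold>= \<^bold>e \<^bold>\<circ> ?c" .
  show "?\<Delta> \<turnstile> ?c \<^bold>\<circ> num w \<^bold>\<circ> bit_tm b \<^bold>\<noteq> \<^bold>e \<^bold>\<circ> ?c"
    by (rule B_snoc_distinct_bits[OF B]) auto
qed

text \<open>Induction from the right end, because axioms (3) and (4) compare strings by their last
  bits.\<close>

lemma num_neq:
  assumes "theory_B \<subseteq> \<Gamma>" and "u \<noteq> v"
  shows "\<Gamma> \<turnstile> num u \<^bold>\<noteq> num v"
  using assms(2)
proof (induction u arbitrary: v rule: rev_induct)
  case Nil
  then obtain c v' where "v = v' @ [c]"
    by (metis rev_exhaust)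
  then show ?case
    using derives_Neq_sym[OF num_snoc_neq_empty[OF assms(1)]] by simp
next
  case (snoc b u)
  show ?case
  proof (cases v rule: rev_exhaust)
    case Nil
    then show ?thesis
      using num_snoc_neq_empty[OF assms(1)] by simp
  next
    case v: (snoc v' c)
    have "\<Gamma> \<turnstile> num u \<^bold>\<circ> bit_tm b \<^bold>\<noteq> num v' \<^bold>\<circ> bit_tm c"
    \<comment> \<open>Equal last bits force \<open>u\<close> and \<open>v'\<close> to differ, so the
      induction hypothesis and axiom (3) apply; unequal ones are separated by axiom (4).\<close>
    proof (cases "b = c")
      case True
      then show ?thesis
        using snoc v B_snoc_cancel[OF assms(1)] by simp
    next
      case False
      then show ?thesis
        using B_snoc_distinct_bits[OF assms(1)] by simp
    qed
    then show ?thesis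
      unfolding v by (rule derives_Neq_cong[OF num_snoc num_snoc, OF assms(1) assms(1)])
  qed
qed

section \<open>The substring relation between numerals\<close>

text \<open>The three shapes match axiom (5), axioms (6)-(7) and axioms (8)-(11).\<close>

lemma bool_list_cases:
  obtains "w = []" | b where "w = [b]" | b w' c where "w = b # w' @ [c]"
  by (metis append_Nil list.exhaust rev_exhaust)

text \<open>Semantic counterpart of axioms (8)-(11): a substring other than the whole misses the
  first or the last letter.\<close>

lemma sublist_Cons_snoc:
  "sublist u (b # w @ [c]) \<longleftrightarrow> u = b # w @ [c] \<or> sublist u (b # w) \<or> sublist u (w @ [c])"
proof -
  have "sublist u (b # w @ [c]) \<longleftrightarrow> suffix u ((b # w) @ [c]) \<or> sublist u (b # w)"
    using sublist_snoc[of u "b # w" c] by simp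
  also have "suffix u ((b # w) @ [c]) \<longleftrightarrow> u = b # w @ [c] \<or> suffix u (w @ [c])"
    by (simp add: suffix_Cons)
  finally show ?thesis
    by (metis append_Cons sublist_append_leftI sublist_Cons_right suffix_imp_sublist)
qed

text \<open>Axioms (8)-(11) lead from \<open>v\<close> to \<open>b # w\<close> and
  \<open>w @ [c]\<close>. The latter is no tail of \<open>v\<close> but is shorter, hence the
  induction on length.\<close>

lemma num_Sub:
  assumes "theory_B \<subseteq> \<Gamma>" and "sublist u v"
  shows "\<Gamma> \<turnstile> num u \<^bold>\<sqsubseteq> num v"
  using assms(2)
proof (induction "length v" arbitrary: v rule: less_induct)
  case less
  \<comment> \<open>Selects the right-to-left half of an axiom's biconditional.\<close>
  note ax = derives.impE[OF derives.conjE2]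
  consider "v = []" | b where "v = [b]" | b w c where "v = b # w @ [c]"
    by (rule bool_list_cases)
  then show ?case
  proof cases
    case 1
    with less.prems show ?thesis
      using ax[OF B_Sub_empty[OF assms(1)] derives.eq_refl] by simp
  next
    case (2 b)
    then have "u = [] \<or> u = [b]"
      using less.prems by (auto simp: sublist_Cons_right prefix_Cons)
    then have "\<Gamma> \<turnstile> num u \<^bold>= \<^bold>e \<^bold>\<or> num u \<^bold>= bit_tm b"
    proof
      assume "u = []"
      then show ?thesis
        by (intro derives.disjI1) (simp add: derives.eq_refl)
    next
      assume "u = [b]"
      then show ?thesis
        using num_single[OF assms(1), of b] by (intro derives.disjI2) simp
    qed
    from ax[OF B_Sub_bit[OF assms(1)] this] show ?thesis
      unfolding 2
      by (rule derives_Sub_cong[OF derives.eq_refl derives_sym[OF num_single[OF assms(1)]]])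
  next
    case (3 b w c)
    have "u = v \<or> sublist u (b # w) \<or> sublist u (w @ [c])"
      using less.prems by (simp only: 3 sublist_Cons_snoc)
    then have "\<Gamma> \<turnstile> num u \<^bold>= bit_tm b \<^bold>\<circ> num w \<^bold>\<circ> bit_tm c \<^bold>\<or>
      num u \<^bold>\<sqsubseteq> bit_tm b \<^bold>\<circ> num w \<^bold>\<or> num u \<^bold>\<sqsubseteq> num w \<^bold>\<circ> bit_tm c"
    proof (elim HOL.disjE)
      assume "u = v"
      then show ?thesis
        using num_Cons_snoc[OF assms(1)] 3 by (intro derives.disjI1) simp
    next
      assume "sublist u (b # w)"
      then have "\<Gamma> \<turnstile> num u \<^bold>\<sqsubseteq> num (b # w)"
        by (intro less.hyps) (simp_all add: 3)
      then show ?thesis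
        by (intro derives.disjI2 derives.disjI1) simp
    next
      assume "sublist u (w @ [c])"
      then have "\<Gamma> \<turnstile> num u \<^bold>\<sqsubseteq> num (w @ [c])"
        by (intro less.hyps) (simp_all add: 3)
      from derives_Sub_cong[OF derives.eq_refl num_snoc[OF assms(1)] this]
      show ?thesis
        by (intro derives.disjI2)
    qed
    from ax[OF B_Sub_Cat[OF assms(1) tvars_num] this] show ?thesis
      unfolding 3
      by (rule derives_Sub_cong[OF derives.eq_refl derives_sym[OF num_Cons_snoc[OF assms(1)]]])
  qed
qed

text \<open>Stated as an elimination rule, so that no finite disjunction over the substrings has to
  be built. \<open>s\<close> may be open, which covers both a quantified variable and a numeral. In
  the induction \<Gamma> varies, since each disjunct of an axiom becomes a new hypothesis.\<close>

lemma Sub_num_cases: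
  assumes "theory_B \<subseteq> \<Gamma>" and "\<Gamma> \<turnstile> s \<^bold>\<sqsubseteq> num v"
    and "\<And>d. sublist d v \<Longrightarrow> insert (s \<^bold>= num d) \<Gamma> \<turnstile> \<chi>"
  shows "\<Gamma> \<turnstile> \<chi>"
  using assms
proof (induction "length v" arbitrary: v \<Gamma> rule: less_induct)
  case less
  note B = less.prems(1) and Sub = less.prems(2) and cases = less.prems(3)
  note ax = derives.impE[OF derives.conjE1]
  consider "v = []" | b where "v = [b]" | b w c where "v = b # w @ [c]"
    by (rule bool_list_cases)
  then show ?case
  proof cases
    case 1
    then have "\<Gamma> \<turnstile> s \<^bold>= num []"
      using ax[OF B_Sub_empty[OF B]] Sub by simp
    then show ?thesis
      by (rule derives_cut[OF _ cases]) simp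
  next
    case (2 b)
    have "\<Gamma> \<turnstile> s \<^bold>\<sqsubseteq> bit_tm b"
      by (rule derives_Sub_cong[OF derives.eq_refl num_single[OF B] Sub[unfolded 2]])
    from ax[OF B_Sub_bit[OF B] this] show ?thesis
    proof (rule derives.disjE)
      show "insert (s \<^bold>= \<^bold>e) \<Gamma> \<turnstile> \<chi>"
        using cases[of "[]"] by simp
      let ?\<Delta> = "insert (s \<^bold>= bit_tm b) \<Gamma>"
      \<comment> \<open>The disjunct names the bit itself, the premise \<open>cases\<close> its
        numeral; a provable equation and a cut bridge the two.\<close>
      have "?\<Delta> \<turnstile> s \<^bold>= num v"
        unfolding 2 by (rule derives_trans[OF derives_hyp derives_sym[OF num_single]]) (use B in auto)
      moreover have "insert (s \<^bold>= num v) ?\<Delta> \<turnstile> \<chi>"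
        using cases[of v] by (subst insert_commute) (simp add: derives_insert)
      ultimately show "?\<Delta> \<turnstile> \<chi>"
        by (rule derives_cut)
    qed
  next
    case (3 b w c)
    \<comment> \<open>The recursive call: substrings of \<open>v'\<close> are substrings of
      \<open>v\<close>, so \<open>cases\<close> still covers them.\<close>
    have shorter: "insert \<psi> \<Gamma> \<turnstile> \<chi>"
      if "insert \<psi> \<Gamma> \<turnstile> s \<^bold>\<sqsubseteq> num v'" "length v' < length v" "sublist v' v" for \<psi> v'
    proof (rule less.hyps[OF that(2) _ that(1)])
      show "theory_B \<subseteq> insert \<psi> \<Gamma>"
        using B by auto
      fix d
      assume "sublist d v'"
      then have "insert (s \<^bold>= num d) \<Gamma> \<turnstile> \<chi>"
        using cases that(3) sublist_order.order_trans by blast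
      then show "insert (s \<^bold>= num d) (insert \<psi> \<Gamma>) \<turnstile> \<chi>"
        by (subst insert_commute) (rule derives_insert)
    qed
    have "\<Gamma> \<turnstile> s \<^bold>\<sqsubseteq> bit_tm b \<^bold>\<circ> num w \<^bold>\<circ> bit_tm c"
      by (rule derives_Sub_cong[OF derives.eq_refl num_Cons_snoc[OF B] Sub[unfolded 3]])
    from ax[OF B_Sub_Cat[OF B tvars_num] this] show ?thesis
    proof (rule derives.disjE)
      let ?\<Delta> = "insert (s \<^bold>= bit_tm b \<^bold>\<circ> num w \<^bold>\<circ> bit_tm c) \<Gamma>"
      have "?\<Delta> \<turnstile> s \<^bold>= num v"
        unfolding 3
        by (rule derives_trans[OF derives_hyp derives_sym[OF num_Cons_snoc]]) (use B in auto)
      moreover have "insert (s \<^bold>= num v) ?\<Delta> \<turnstile> \<chi>"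
        using cases[of v] by (subst insert_commute) (simp add: derives_insert)
      ultimately show "?\<Delta> \<turnstile> \<chi>"
        by (rule derives_cut)
    next
      \<comment> \<open>Disjunction associates to the right, so the last two alternatives arrive as
        a single hypothesis that is split once more.\<close>
      let ?\<phi> = "s \<^bold>\<sqsubseteq> bit_tm b \<^bold>\<circ> num w" and ?\<psi> = "s \<^bold>\<sqsubseteq> num w \<^bold>\<circ> bit_tm c"
      have "insert ?\<phi> \<Gamma> \<turnstile> \<chi>"
        by (rule shorter[of _ "b # w"]) (auto simp: 3 derives_hyp sublist_Cons_snoc)
      moreover have "insert ?\<psi> \<Gamma> \<turnstile> \<chi>"
      proof (rule shorter[of _ "w @ [c]"])
        have "theory_B \<subseteq> insert ?\<psi> \<Gamma>"
          using B by auto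
        from derives_Sub_cong[OF derives.eq_refl derives_sym[OF num_snoc[OF this]] derives_hyp]
        show "insert ?\<psi> \<Gamma> \<turnstile> s \<^bold>\<sqsubseteq> num (w @ [c])" .
      qed (auto simp: 3 sublist_Cons_snoc)
      ultimately show "insert (?\<phi> \<^bold>\<or> ?\<psi>) \<Gamma> \<turnstile> \<chi>"
        by (intro derives.disjE[OF derives_hyp])
          (subst insert_commute, erule derives_insert)+
    qed
  qed
qed

text \<open>Otherwise \<open>num u\<close> would equal \<open>num d\<close> for some substring
  \<open>d\<close> of \<open>v\<close>; but \<open>u\<close> is none of these, so
  \<open>num_neq\<close> refutes every case.\<close>

lemma num_not_Sub:
  assumes "theory_B \<subseteq> \<Gamma>" and "\<not> sublist u v"
  shows "\<Gamma> \<turnstile> \<^bold>\<not> (num u \<^bold>\<sqsubseteq> num v)"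
proof -
  let ?\<Delta> = "insert (num u \<^bold>\<sqsubseteq> num v) \<Gamma>"
  have B: "theory_B \<subseteq> ?\<Delta>"
    using assms(1) by auto
  have contra: "?\<Delta> \<turnstile> \<chi>" for \<chi>
  proof (rule Sub_num_cases[OF B derives_hyp])
    fix d
    assume "sublist d v"
    with assms(2) have "u \<noteq> d"
      by auto
    from num_neq[OF B this] have "?\<Delta> \<turnstile> num u \<^bold>\<noteq> num d" .
    then show "insert (num u \<^bold>= num d) ?\<Delta> \<turnstile> \<chi>"
      by (rule derives.negE[OF derives_hyp derives_insert])
  qed
  show ?thesis
    by (rule derives.negI[OF contra contra])
qed

section \<open>Derivations under an assignment\<close>

text \<open>Equations are kept only for the variables in \<open>V\<close>, which leaves all others
  fresh for generalization.\<close>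

definition hyps :: "(nat \<Rightarrow> bool list) \<Rightarrow> nat set \<Rightarrow> fm set" where
  "hyps a V = theory_B \<union> (\<lambda>x. Var x \<^bold>= num (a x)) ` V"

lemma theory_B_subset_hyps: "theory_B \<subseteq> hyps a V"
  by (simp add: hyps_def)

lemma hyps_mono: "hyps a V \<turnstile> \<phi> \<Longrightarrow> V \<subseteq> W \<Longrightarrow> hyps a W \<turnstile> \<phi>"
  by (erule derives.weaken) (auto simp: hyps_def)

lemma hyps_upd_subset: "hyps (a(x := d)) V \<subseteq> insert (Var x \<^bold>= num d) (hyps a (V - {x}))"
  by (auto simp: hyps_def)

lemma hyps_fresh: "\<psi> \<in> hyps a V \<Longrightarrow> x \<notin> V \<Longrightarrow> x \<notin> fvars \<psi>"
  by (auto simp: hyps_def theory_B_closed)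

lemma hyps_Forall:
  assumes "hyps a V \<turnstile> \<phi>" and "x \<notin> V"
  shows "hyps a V \<turnstile> Forall x \<phi>"
  by (rule derives.allI[where y = x]) (use assms hyps_fresh in auto)

text \<open>The equation for \<open>x\<close> has to leave the hypotheses. It is discharged into an
  implication, generalized over \<open>x\<close> and instantiated with \<open>num d\<close>, which
  makes its premise reflexive and supplies the witness.\<close>

lemma hyps_Exists:
  assumes "hyps (a(x := d)) V \<turnstile> \<phi>"
  shows "hyps a (V - {x}) \<turnstile> Exists x \<phi>"
proof -
  have "hyps a (V - {x}) \<turnstile> Var x \<^bold>= num d \<^bold>\<longrightarrow> \<phi>"
    using derives.weaken[OF assms hyps_upd_subset] by (rule derives.impI)
  then have "hyps a (V - {x}) \<turnstile> Forall x (Var x \<^bold>= num d \<^bold>\<longrightarrow> \<phi>)"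
    by (rule hyps_Forall) simp
  from derives.allE[OF this, of "num d"]
  have "hyps a (V - {x}) \<turnstile> num d \<^bold>= num d \<^bold>\<longrightarrow> subst \<phi> x (num d)"
    by (simp add: free_for_closed tsubst_fresh)
  then have "hyps a (V - {x}) \<turnstile> subst \<phi> x (num d)"
    using derives.eq_refl by (rule derives.impE)
  then show ?thesis
    by (rule derives.exI) (simp add: free_for_closed)
qed

section \<open>Evaluation of terms and derivability of true formulas\<close>

lemma BT_struct_simps [simp]:
  "int_e \<BB> = []" "int_0 \<BB> = [False]" "int_1 \<BB> = [True]" "int_cat \<BB> = (@)"
  "int_sub \<BB> = sublist"
  by (simp_all add: BT_struct_def)

lemma hyps_tval:
  assumes "tvars t \<subseteq> V"
  shows "hyps a V \<turnstile> t \<^bold>= num (tval \<BB> a t)"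
  using assms
proof (induction t)
  case (Var x)
  show ?case
    by (rule derives.assm) (use Var in \<open>simp add: hyps_def\<close>)
next
  case Zero
  show ?case
    using derives_sym[OF num_single[OF theory_B_subset_hyps, of a V False]]
    by (simp add: bit_tm_def)
next
  case One
  show ?case
    using derives_sym[OF num_single[OF theory_B_subset_hyps, of a V True]]
    by (simp add: bit_tm_def)
next
  case (Cat s t)
  have "hyps a V \<turnstile> s \<^bold>\<circ> t \<^bold>= num (tval \<BB> a s) \<^bold>\<circ> num (tval \<BB> a t)"
    using Cat by (simp add: derives_Cat_cong)
  also have "hyps a V \<turnstile> num (tval \<BB> a s) \<^bold>\<circ> num (tval \<BB> a t) \<^bold>= num (tval \<BB> a (s \<^bold>\<circ> t))"
    using derives_sym[OF num_append[OF theory_B_subset_hyps]] by simp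
  finally show ?case .
qed (simp add: derives.eq_refl)

lemma hyps_Sub:
  assumes "sublist (tval \<BB> a s) (tval \<BB> a t)" and "tvars s \<union> tvars t \<subseteq> V"
  shows "hyps a V \<turnstile> s \<^bold>\<sqsubseteq> t"
  by (rule derives_Sub_cong[OF derives_sym[OF hyps_tval] derives_sym[OF hyps_tval]
        num_Sub[OF theory_B_subset_hyps assms(1)]])
    (use assms(2) in auto)

text \<open>Taking exactly \<open>fvars \<phi>\<close> as the recorded variables keeps a quantified
  variable out of the hypotheses of the quantified formula. The assignment is arbitrary in the
  induction because quantifiers update it.\<close>

lemma Sigma_complete_hyps:
  assumes "Sigma_fm \<phi>" and "sat \<BB> a \<phi>"
  shows "hyps a (fvars \<phi>) \<turnstile> \<phi>"
  using assms
proof (induction arbitrary: a)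
  case (1 s t)
  then show ?case
    by (intro hyps_Sub) auto
next
  case (2 s t)
  let ?G = "hyps a (fvars (\<^bold>\<not> (s \<^bold>\<sqsubseteq> t)))"
  let ?\<Delta> = "insert (s \<^bold>\<sqsubseteq> t) ?G"
  have neg: "?G \<turnstile> \<^bold>\<not> (num (tval \<BB> a s) \<^bold>\<sqsubseteq> num (tval \<BB> a t))"
    using 2 by (intro num_not_Sub theory_B_subset_hyps) simp
  have pos: "?\<Delta> \<turnstile> num (tval \<BB> a s) \<^bold>\<sqsubseteq> num (tval \<BB> a t)"
    by (rule derives_Sub_cong[OF derives_insert derives_insert derives_hyp])
      (auto intro: hyps_tval)
  show ?case
    by (rule derives.negI[OF pos derives_insert[OF neg]])
next
  case (3 s t)
  let ?G = "hyps a (fvars (s \<^bold>= t))"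
  have "?G \<turnstile> s \<^bold>= num (tval \<BB> a s)"
    by (rule hyps_tval) simp
  also have "?G \<turnstile> num (tval \<BB> a s) \<^bold>= t"
    using derives_sym[OF hyps_tval[of t "fvars (s \<^bold>= t)" a]] 3 by simp
  finally show ?case .
next
  case (4 s t)
  then show ?case
    by (intro derives_Neq_cong[OF hyps_tval hyps_tval num_neq] theory_B_subset_hyps) auto
next
  case (5 \<phi> \<psi>)
  then show ?case
    by (auto intro!: derives.conjI intro: hyps_mono)
next
  case (6 \<phi> \<psi>)
  then have "hyps a (fvars \<phi>) \<turnstile> \<phi> \<or> hyps a (fvars \<psi>) \<turnstile> \<psi>"
    by auto
  then show ?case
    by (auto intro: derives.disjI1 derives.disjI2 hyps_mono)
next
  case (7 \<phi> x t)
  then obtain d where d: "sat \<BB> (a(x := d)) (Var x \<^bold>\<sqsubseteq> t \<^bold>\<and> \<phi>)"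
    by auto
  have "hyps (a(x := d)) (fvars (Var x \<^bold>\<sqsubseteq> t \<^bold>\<and> \<phi>)) \<turnstile> Var x \<^bold>\<sqsubseteq> t \<^bold>\<and> \<phi>"
  proof (rule derives.conjI)
    \<comment> \<open>The induction hypothesis covers only \<phi>; the bounding atom is derived
      directly.\<close>
    show "hyps (a(x := d)) (fvars (Var x \<^bold>\<sqsubseteq> t \<^bold>\<and> \<phi>)) \<turnstile> Var x \<^bold>\<sqsubseteq> t"
      using d by (intro hyps_Sub) auto
    have "sat \<BB> (a(x := d)) \<phi>"
      using d by (simp only: sat.simps)
    from 7(3)[OF this]
    show "hyps (a(x := d)) (fvars (Var x \<^bold>\<sqsubseteq> t \<^bold>\<and> \<phi>)) \<turnstile> \<phi>"
      by (rule hyps_mono) auto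
  qed
  from hyps_Exists[OF this] show ?case
    by simp
next
  case (8 \<phi> x t)
  let ?V = "fvars (BForall x t \<phi>)"
  let ?v = "tval \<BB> a t"
  let ?\<Delta> = "insert (Var x \<^bold>\<sqsubseteq> t) (hyps a ?V)"
  \<comment> \<open>Since \<open>x\<close> does not occur in \<open>t\<close>, the bound stays the
    same string in every branch.\<close>
  have t: "tval \<BB> (a(x := d)) t = ?v" for d
    using \<open>x \<notin> tvars t\<close> by (induction t) auto
  have "?\<Delta> \<turnstile> \<phi>"
  proof (rule Sub_num_cases)
    show "theory_B \<subseteq> ?\<Delta>"
      using theory_B_subset_hyps by blast
    have "hyps a ?V \<turnstile> t \<^bold>= num ?v"
      using \<open>x \<notin> tvars t\<close> by (intro hyps_tval) auto
    then show "?\<Delta> \<turnstile> Var x \<^bold>\<sqsubseteq> num ?v"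
      by (rule derives_Sub_cong[OF derives.eq_refl derives_insert derives_hyp])
    fix d
    assume "sublist d ?v"
    moreover have "sat \<BB> (a(x := d)) (Var x \<^bold>\<sqsubseteq> t \<^bold>\<longrightarrow> \<phi>)"
      using 8(4)[unfolded sat.simps(7)] by (rule spec)
    ultimately have "sat \<BB> (a(x := d)) \<phi>"
      by (simp add: t)
    then have "hyps (a(x := d)) (fvars \<phi>) \<turnstile> \<phi>"
      by (rule 8(3))
    \<comment> \<open>The equation for \<open>x\<close> is the branch assumption; all other
      hypotheses already lie in \<open>hyps a ?V\<close>.\<close>
    then show "insert (Var x \<^bold>= num d) ?\<Delta> \<turnstile> \<phi>"
      by (rule derives.weaken) (auto simp: hyps_def)
  qed
  then have "hyps a ?V \<turnstile> Var x \<^bold>\<sqsubseteq> t \<^bold>\<longrightarrow> \<phi>"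
    by (rule derives.impI)
  then show ?case
    by (rule hyps_Forall) simp
next
  case (9 \<phi> x)
  then obtain d where "hyps (a(x := d)) (fvars \<phi>) \<turnstile> \<phi>"
    by auto
  from hyps_Exists[OF this] show ?case
    by simp
qed

theorem theorem4:
  fixes \<phi> :: fm
  assumes "Sigma_fm \<phi>" and "sentence \<phi>" and "\<BB> \<Turnstile> \<phi>"
  shows "theory_B \<turnstile> \<phi>"
proof -
  \<comment> \<open>Any assignment would do. A sentence has no free variables, so
    \<open>hyps\<close> then reduces to \<open>theory_B\<close>.\<close>
  have "sat \<BB> (\<lambda>_. []) \<phi>"
    using assms(3) by (simp add: models_def)
  from Sigma_complete_hyps[OF assms(1) this] show ?thesis
    using assms(2) by (simp add: sentence_def hyps_def)
qed

end
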